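(* Let $(\Sigma,\sharp)$ be a positive ranked alphabet, and let $A=\langle\mathbb K^m,\{A^x\}_{x\in\Sigma},\odot^A,\alpha\rangle$ and $B=\langle\mathbb K^n,\{B^x\}_{x\in\Sigma},\odot^B,\beta\rangle$ be two HWMs over $(\Sigma,\sharp)$, computing the series $r_A$ and $r_B$. Identify $\mathbb K^m\otimes\mathbb K^n$ with $\mathbb K^{mn}$ via $\mathbf e_i\otimes\mathbf e_j\mapsto\mathbf e_{n(i-1)+j}$, and correspondingly index the basis of $\mathbb K^{mn}$ by pairs $(i,j)\in[m]\times[n]$. Define the HWM $D=\langle\mathbb K^m\otimes\mathbb K^n,\{D^x\}_{x\in\Sigma},\odot,\delta\rangle$ by: - $D^x=A^x\otimes B^x$ for all $x\in\Sigma$, regarded as an element of $\bigotimes^{\sharp x}(\mathbb K^m\otimes\mathbb K^n)$, i.e. $D^x_{(i_1,j_1)\dots(i_{\sharp x},j_{\sharp x})}=A^x_{i_1\dots i_{\sharp x}}B^x_{j_1\dots j_{\sharp x}}$; - $(\mathbf a_1\otimes\mathbf b_1)\odot(\mathbf a_2\otimes\mathbf b_2)=(\mathbf a_1\odot^A\mathbf a_2)\otimes(\mathbf b_1\odot^B\mathbf b_2)$ for all $\mathbf a_1,\mathbf a_2\in\mathbb K^m$ and $\mathbf b_1,\mathbf b_2\in\mathbb K^n$; - $\delta=\alpha\otimes\beta$, i.e. $\delta^\top(\mathbf a\otimes\mathbf b)=(\alpha^\top\mathbf a)(\beta^\top\mathbf b)$ for all $\mathbf a\in\mathbb K^m$,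 $\mathbf b\in\mathbb K^n$. Then $r_D(G)=r_A(G)\,r_B(G)$ for every hypergraph $G$ over $(\Sigma,\sharp)$.
   Context: Throughout, $\mathbb K=\mathbb R$ or $\mathbb C$, $[d]=\{1,\dots,d\}$, and $(\mathbf e_1,\dots,\mathbf e_d)$ is the canonical basis of $\mathbb K^d$. A ranked alphabet $(\Sigma,\sharp)$ is a finite set $\Sigma$ with an arity map $\sharp:\Sigma\to\mathbb N$; it is positive if $\sharp x\ge 1$ for all $x\in\Sigma$. A hypergraph $G=(V,E,l)$ over a positive ranked alphabet $(\Sigma,\sharp)$ consists of a non-empty finite set $V$ (vertices), a map $l:V\to\Sigma$, and a partition $E$ (whose non-empty blocks are called hyperedges) of the set of ports $P_G=\{(v,j): v\in V, 1\le j\le \sharp v\}$, where $\sharp v=\sharp l(v)$. A product on $\mathbb K^d$ is a bilinear map $\odot:\mathbb K^d\times\mathbb K^d\to\mathbb K^d$ that is associative and symmetric. A rank $d$ ($d\geq1$) Hypergraph Weighted Model (HWM) over $(\Sigma,\sharp)$ is a tuple $M=\langle \mathbb K^d,\{T^x\}_{x\in\Sigma},\odot,\alpha\rangle$ where $\odot$ is a product on $\mathbb K^d$, $\alpha\in\mathbb K^d$, and $T^x\in\bigotimes^{\sharp x}\mathbb K^d$ (viewed as an array $(T^x_{i_1\dots i_{\sharp x}})$) for each $x$. It computes the series $$r_M(G)=\sum_{\gamma:P_G\to[d]}\ \Big(\prod_{v\in V}T^{l(v)}_{\gamma(v,1)\dots\gamma(v,\sharp v)}\Big)\prod_{h\in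 E}\alpha^\top\Big(\bigodot_{p\in h}\mathbf e_{\gamma(p)}\Big)$$ (one factor for each port of $h$). *)

theory Defs
  imports "Jordan_Normal_Form.Matrix" "HOL-Library.FuncSet" "HOL-Library.Disjoint_Sets"
begin

definition positive_ranked_alphabet :: "'x set \<Rightarrow> ('x \<Rightarrow> nat) \<Rightarrow> bool" where
  "positive_ranked_alphabet \<Sigma> ar \<longleftrightarrow> finite \<Sigma> \<and> (\<forall>x\<in>\<Sigma>. 1 \<le> ar x)"

record ('v, 'x) hypergraph =
  verts :: "'v set"
  lab :: "'v \<Rightarrow> 'x"
  hyperedges :: "('v \<times> nat) set set"

definition ports :: "('x \<Rightarrow> nat) \<Rightarrow> ('v, 'x) hypergraph \<Rightarrow> ('v \<times> nat) set" where
  "ports ar G = {(v, j). v \<in> verts G \<and> 1 \<le> j \<and> j \<le> ar (lab G v)}"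

definition is_hypergraph :: "'x set \<Rightarrow> ('x \<Rightarrow> nat) \<Rightarrow> ('v, 'x) hypergraph \<Rightarrow> bool" where
  "is_hypergraph \<Sigma> ar G \<longleftrightarrow>
     finite (verts G) \<and> verts G \<noteq> {} \<and>
     (\<forall>v\<in>verts G. lab G v \<in> \<Sigma>) \<and>
     partition_on (ports ar G) (hyperedges G)"

definition is_product :: "nat \<Rightarrow> ('k::field vec \<Rightarrow> 'k vec \<Rightarrow> 'k vec) \<Rightarrow> bool" where
  "is_product d f \<longleftrightarrow>
     (\<forall>u\<in>carrier_vec d. \<forall>v\<in>carrier_vec d. f u v \<in> carrier_vec d) \<and>
     (\<forall>u\<in>carrier_vec d. \<forall>v\<in>carrier_vec d. \<forall>w\<in>carrier_vec d.
        f (u + v) w = f u w + f v w \<and> f u (v + w) = f u v + f u w) \<and>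
     (\<forall>c. \<forall>u\<in>carrier_vec d. \<forall>v\<in>carrier_vec d.
        f (c \<cdot>\<^sub>v u) v = c \<cdot>\<^sub>v f u v \<and> f u (c \<cdot>\<^sub>v v) = c \<cdot>\<^sub>v f u v) \<and>
     (\<forall>u\<in>carrier_vec d. \<forall>v\<in>carrier_vec d. \<forall>w\<in>carrier_vec d.
        f (f u v) w = f u (f v w)) \<and>
     (\<forall>u\<in>carrier_vec d. \<forall>v\<in>carrier_vec d. f u v = f v u)"

text \<open>The iterated product of \<open>g p\<close> over a finite non-empty set \<open>h\<close>. A product need not have a
  unit, so the fold starts from \<open>None\<close>; the value for empty or infinite \<open>h\<close> is irrelevant.\<close>

definition big_product :: "('a \<Rightarrow> 'a \<Rightarrow> 'a) \<Rightarrow> ('p \<Rightarrow> 'a) \<Rightarrow> 'p set \<Rightarrow> 'a" where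
  "big_product f g h =
     the (Finite_Set.fold (\<lambda>p z. Some (case z of None \<Rightarrow> g p | Some w \<Rightarrow> f (g p) w)) None h)"

lemma big_product_singleton: "big_product f g {p} = g p"
proof -
  interpret comp_fun_commute_on "{p}"
    "\<lambda>p z. Some (case z of None \<Rightarrow> g p | Some w \<Rightarrow> f (g p) w)"
    by standard auto
  show ?thesis
    by (simp add: big_product_def)
qed

lemma big_product_insert:
  assumes prod: "is_product d f" and fin: "finite h" and ne: "h \<noteq> {}" and p: "p \<notin> h"
    and g: "\<And>q. q \<in> insert p h \<Longrightarrow> g q \<in> carrier_vec d"
  shows "big_product f g (insert p h) = f (g p) (big_product f g h)"
    and "big_product f g h \<in> carrier_vec d"
proof -
  define S where "S = insert p h"
  define B where "B = insert None (Some ` (carrier_vec d :: 'a vec set))"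
  define F where "F = (\<lambda>p z. Some (case z of None \<Rightarrow> g p | Some w \<Rightarrow> f (g p) w))"
  define F' where "F' = (\<lambda>p z. if z \<in> B then F p z else z)"
  have FB: "F q z \<in> B" if "q \<in> S" "z \<in> B" for q z
    using that g prod unfolding S_def B_def F_def is_product_def by auto
  have comm: "F q (F r z) = F r (F q z)" if "q \<in> S" "r \<in> S" "z \<in> B" for q r z
  proof -
    have car: "g q \<in> carrier_vec d" "g r \<in> carrier_vec d" using that g by (auto simp: S_def)
    show ?thesis
    proof (cases z)
      case None
      then show ?thesis using car prod by (auto simp: F_def is_product_def)
    next
      case (Some w)
      then have w: "w \<in> carrier_vec d" using that by (auto simp: B_def)
      have "f (g q) (f (g r) w) = f (f (g q) (g r)) w"
        using car w prod unfolding is_product_def by metis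
      also have "\<dots> = f (f (g r) (g q)) w"
        using car w prod unfolding is_product_def by metis
      also have "\<dots> = f (g r) (f (g q) w)"
        using car w prod unfolding is_product_def by metis
      finally show ?thesis using Some by (simp add: F_def)
    qed
  qed
  interpret comp_fun_commute_on S F'
    by standard (auto simp: F'_def fun_eq_iff FB comm)
  have eq: "Finite_Set.fold F None T = Finite_Set.fold F' None T" if "T \<subseteq> S" for T
    by (rule fold_closed_eq[where B = B]) (use that FB in \<open>auto simp: F'_def B_def\<close>)
  have inB: "Finite_Set.fold F' None T \<in> B" if "T \<subseteq> S" "finite T" for T
    using that(2,1)
  proof (induction T)
    case empty
    then show ?case by (simp add: B_def)
  next
    case (insert q T)
    then have "Finite_Set.fold F' None (insert q T) = F' q (Finite_Set.fold F' None T)"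
      by (intro fold_insert) auto
    then show ?case using insert by (simp add: F'_def FB)
  qed
  have ins: "Finite_Set.fold F' None (insert q T) = F q (Finite_Set.fold F' None T)"
    if "insert q T \<subseteq> S" "finite T" "q \<notin> T" for q T
  proof -
    have "Finite_Set.fold F' None (insert q T) = F' q (Finite_Set.fold F' None T)"
      using that by (intro fold_insert) auto
    then show ?thesis using that inB[of T] by (simp add: F'_def)
  qed
  have "\<exists>w\<in>carrier_vec d. Finite_Set.fold F' None h = Some w"
  proof -
    obtain q h' where h: "h = insert q h'" "q \<notin> h'" using ne by (meson mk_disjoint_insert ex_in_conv)
    then have "Finite_Set.fold F' None h = F q (Finite_Set.fold F' None h')"
      unfolding h(1) by (intro ins) (use h fin in \<open>auto simp: S_def\<close>)
    moreover have "\<dots> \<in> B" using FB inB[of h'] h fin by (auto simp: S_def)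
    ultimately show ?thesis by (auto simp: F_def B_def)
  qed
  then obtain w where w: "w \<in> carrier_vec d" "Finite_Set.fold F' None h = Some w" by blast
  have hw: "big_product f g h = w"
    using w eq[of h] by (simp add: big_product_def F_def[symmetric] S_def subset_insertI)
  show "big_product f g h \<in> carrier_vec d" using w hw by simp
  have "Finite_Set.fold F None (insert p h) = Some (f (g p) w)"
  proof -
    have "Finite_Set.fold F' None (insert p h) = F p (Finite_Set.fold F' None h)"
      by (intro ins) (use fin p in \<open>auto simp: S_def\<close>)
    then show ?thesis using eq[of "insert p h"] w by (simp add: S_def F_def)
  qed
  then show "big_product f g (insert p h) = f (g p) (big_product f g h)"
    unfolding hw by (simp add: big_product_def F_def[symmetric])
qed

text \<open>The coordinates of a rank \<open>d\<close> model are \<open>0, \<dots>, d - 1\<close>. A tensor of order \<open>r\<close> over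
  \<open>K\<^sup>d\<close> is an array on the index lists of length \<open>r\<close> with entries below \<open>d\<close>; its values on all
  other lists are never used.\<close>

record ('x, 'k) hwm =
  hwm_rank :: nat
  hwm_tensor :: "'x \<Rightarrow> nat list \<Rightarrow> 'k"
  hwm_product :: "'k vec \<Rightarrow> 'k vec \<Rightarrow> 'k vec"
  hwm_final :: "'k vec"

definition is_hwm :: "('x, 'k::field) hwm \<Rightarrow> bool" where
  "is_hwm M \<longleftrightarrow>
     1 \<le> hwm_rank M \<and>
     is_product (hwm_rank M) (hwm_product M) \<and>
     hwm_final M \<in> carrier_vec (hwm_rank M)"

definition hwm_series :: "('x \<Rightarrow> nat) \<Rightarrow> ('x, 'k::field) hwm \<Rightarrow> ('v, 'x) hypergraph \<Rightarrow> 'k" where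
  "hwm_series ar M G =
     (\<Sum>\<gamma> \<in> ports ar G \<rightarrow>\<^sub>E {0..<hwm_rank M}.
        (\<Prod>v\<in>verts G. hwm_tensor M (lab G v) (map (\<lambda>j. \<gamma> (v, j)) [1..<Suc (ar (lab G v))])) *
        (\<Prod>h\<in>hyperedges G.
           hwm_final M \<bullet> big_product (hwm_product M) (\<lambda>p. unit_vec (hwm_rank M) (\<gamma> p)) h))"

text \<open>With coordinates counted from \<open>0\<close>, the identification of \<open>K\<^sup>m \<otimes> K\<^sup>n\<close> with \<open>K\<^sup>m\<^sup>n\<close> sends
  \<open>e\<^sub>i \<otimes> e\<^sub>j\<close> to \<open>e\<^sub>k\<close> with \<open>k = n * i + j\<close>.\<close>

definition tensor_vec :: "'k::field vec \<Rightarrow> 'k vec \<Rightarrow> 'k vec" where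
  "tensor_vec a b =
     vec (dim_vec a * dim_vec b) (\<lambda>k. a $ (k div dim_vec b) * b $ (k mod dim_vec b))"

lemma tensor_vec_unit_vec:
  assumes "i < m" "j < n"
  shows "tensor_vec (unit_vec m i) (unit_vec n j) = (unit_vec (m * n) (n * i + j) :: 'k::field vec)"
proof (rule eq_vecI)
  fix k assume "k < dim_vec (unit_vec (m * n) (n * i + j) :: 'k vec)"
  then have k: "k < m * n" by simp
  then have "k div n < m" by (simp add: less_mult_imp_div_less)
  moreover have "k mod n < n" using assms by simp
  moreover have "k = n * i + j \<longleftrightarrow> k div n = i \<and> k mod n = j"
    using assms by (auto simp: algebra_simps)
  ultimately show "tensor_vec (unit_vec m i) (unit_vec n j) $ k = (unit_vec (m * n) (n * i + j) :: 'k vec) $ k"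
    using k assms by (auto simp: tensor_vec_def unit_vec_def)
qed (simp add: tensor_vec_def)

definition is_tensor_hwm ::
  "'x set \<Rightarrow> ('x \<Rightarrow> nat) \<Rightarrow> ('x, 'k::field) hwm \<Rightarrow> ('x, 'k) hwm \<Rightarrow> ('x, 'k) hwm \<Rightarrow> bool" where
  "is_tensor_hwm \<Sigma> ar A B D \<longleftrightarrow>
     is_hwm D \<and>
     hwm_rank D = hwm_rank A * hwm_rank B \<and>
     (\<forall>x\<in>\<Sigma>. \<forall>is js.
        length is = ar x \<and> length js = ar x \<and>
        set is \<subseteq> {0..<hwm_rank A} \<and> set js \<subseteq> {0..<hwm_rank B} \<longrightarrow>
        hwm_tensor D x (map2 (\<lambda>i j. hwm_rank B * i + j) is js)
          = hwm_tensor A x is * hwm_tensor B x js) \<and>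
     (\<forall>a1\<in>carrier_vec (hwm_rank A). \<forall>a2\<in>carrier_vec (hwm_rank A).
      \<forall>b1\<in>carrier_vec (hwm_rank B). \<forall>b2\<in>carrier_vec (hwm_rank B).
        hwm_product D (tensor_vec a1 b1) (tensor_vec a2 b2)
          = tensor_vec (hwm_product A a1 a2) (hwm_product B b1 b2)) \<and>
     hwm_final D = tensor_vec (hwm_final A) (hwm_final B)"

end

theory Submission
  imports Defs
begin

text \<open>A product on \<open>K\<^sup>d\<close> is determined by its structure constants, and associativity and symmetry
  become polynomial identities between them. The tensor product of two algebras has as structure
  constants the products of the two families, indexed by quotients and remainders modulo \<open>n\<close>; every
  sum over \<open>m * n\<close> then factors into a sum over \<open>m\<close> times a sum over \<open>n\<close>, which gives existence.
  For the series, a map from the ports to \<open>[m] \<times> [n]\<close> is a pair of maps, and each vertex factor and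
  each hyperedge factor of \<open>D\<close> is the product of those of \<open>A\<close> and \<open>B\<close>.\<close>

section \<open>Sums indexed by quotient and remainder\<close>

lemma sum_mult_div_mod:
  fixes g :: "nat \<Rightarrow> nat \<Rightarrow> 'a::comm_monoid_add"
  shows "(\<Sum>k<m * n. g (k div n) (k mod n)) = (\<Sum>i<m. \<Sum>j<n. g i j)"
proof -
  have "(\<Sum>k<m * n. g (k div n) (k mod n)) = (\<Sum>(i, j)\<in>{..<m} \<times> {..<n}. g i j)"
  proof (rule sum.reindex_bij_witness[where j = "\<lambda>k. (k div n, k mod n)" and i = "\<lambda>(i, j). i * n + j"])
    fix k assume "k \<in> {..<m * n}"
    \<comment> \<open>A non-empty range forces \<open>n\<close> to be positive; for n = 0 the
      remainder would have no bound.\<close>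
    moreover from this have "0 < n" by (cases n) auto
    ultimately show "(k div n, k mod n) \<in> {..<m} \<times> {..<n}"
      by (auto simp: less_mult_imp_div_less)
  next
    fix p assume "p \<in> {..<m} \<times> {..<n}"
    then obtain i j where p: "p = (i, j)" "i < m" "j < n" by auto
    have "i * n + j < Suc i * n" using p by simp
    also have "\<dots> \<le> m * n" using p by (intro mult_le_mono1) simp
    finally show "(\<lambda>(i, j). i * n + j) p \<in> {..<m * n}" using p by simp
  qed auto
  then show ?thesis by (simp add: sum.cartesian_product)
qed

lemma sum_mult_div_mod_prod:
  fixes g h :: "nat \<Rightarrow> 'a::comm_semiring_0"
  shows "(\<Sum>k<m * n. g (k div n) * h (k mod n)) = (\<Sum>i<m. g i) * (\<Sum>j<n. h j)"
  using sum_mult_div_mod[of "\<lambda>i j. g i * h j" n m] by (simp add: sum_product)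

section \<open>Products and their structure constants\<close>

text \<open>Binary additivity is turned into a finite sum by cutting \<open>u\<close> off after
  \<open>t\<close> coordinates and letting \<open>t\<close> grow to \<open>d\<close>, one multiple
  of a unit vector at a time.\<close>

lemma linear_functional_expand:
  fixes \<phi> :: "'k::field vec \<Rightarrow> 'k"
  assumes add: "\<And>u v. u \<in> carrier_vec d \<Longrightarrow> v \<in> carrier_vec d \<Longrightarrow> \<phi> (u + v) = \<phi> u + \<phi> v"
    and smult: "\<And>c u. u \<in> carrier_vec d \<Longrightarrow> \<phi> (c \<cdot>\<^sub>v u) = c * \<phi> u"
    and u: "u \<in> carrier_vec d"
  shows "\<phi> u = (\<Sum>k<d. u $ k * \<phi> (unit_vec d k))"
proof -
  have "\<phi> (vec d (\<lambda>i. if i < t then u $ i else 0)) = (\<Sum>k<t. u $ k * \<phi> (unit_vec d k))"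
    if "t \<le> d" for t
    using that
  proof (induction t)
    case 0
    \<comment> \<open>Writing the zero vector as a multiple of \<open>u\<close> lets homogeneity
      give the value 0.\<close>
    have "vec d (\<lambda>i. if i < 0 then u $ i else 0) = 0 \<cdot>\<^sub>v u" using u by auto
    then show ?case using smult[OF u, of 0] by simp
  next
    case (Suc t)
    have "vec d (\<lambda>i. if i < Suc t then u $ i else 0)
        = vec d (\<lambda>i. if i < t then u $ i else 0) + u $ t \<cdot>\<^sub>v unit_vec d t"
      using Suc.prems by (intro eq_vecI) (auto simp: less_Suc_eq)
    then show ?case using Suc by (simp add: add smult)
  qed
  moreover have "vec d (\<lambda>i. if i < d then u $ i else 0) = u" using u by auto
  ultimately show ?thesis by (metis order_refl)
qed

definition struct_const :: "nat \<Rightarrow> ('k::field vec \<Rightarrow> 'k vec \<Rightarrow> 'k vec) \<Rightarrow> nat \<Rightarrow> nat \<Rightarrow> nat \<Rightarrow> 'k" where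
  "struct_const d f k l r = f (unit_vec d k) (unit_vec d l) $ r"

definition struct_product :: "nat \<Rightarrow> (nat \<Rightarrow> nat \<Rightarrow> nat \<Rightarrow> 'k) \<Rightarrow> 'k::field vec \<Rightarrow> 'k vec \<Rightarrow> 'k vec" where
  "struct_product d c u v = vec d (\<lambda>r. \<Sum>k<d. \<Sum>l<d. u $ k * v $ l * c k l r)"

text \<open>A coordinate of \<open>f u v\<close> is a linear functional of each argument, so
  \<open>linear_functional_expand\<close> applies first in \<open>u\<close> and then in
  \<open>v\<close>.\<close>

lemma is_product_expand:
  assumes f: "is_product d f" and u: "u \<in> carrier_vec d" and v: "v \<in> carrier_vec d"
  shows "f u v = struct_product d (struct_const d f) u v"
proof (rule eq_vecI)
  have car: "f x y \<in> carrier_vec d" if "x \<in> carrier_vec d" "y \<in> carrier_vec d" for x y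
    using f that by (simp add: is_product_def)
  show "dim_vec (f u v) = dim_vec (struct_product d (struct_const d f) u v)"
    using car[OF u v] by (simp add: struct_product_def)
  fix r assume "r < dim_vec (struct_product d (struct_const d f) u v)"
  then have r: "r < d" by (simp add: struct_product_def)
  have idx: "(x + y) $ r = x $ r + y $ r" "(c \<cdot>\<^sub>v x) $ r = c * x $ r"
    if "x \<in> carrier_vec d" "y \<in> carrier_vec d" for x y :: "'a vec" and c
    using that r by auto
  have "f u v $ r = (\<Sum>k<d. u $ k * f (unit_vec d k) v $ r)"
    using f v by (intro linear_functional_expand[OF _ _ u]) (auto simp: is_product_def idx)
  also have "\<dots> = (\<Sum>k<d. u $ k * (\<Sum>l<d. v $ l * struct_const d f k l r))"
    unfolding struct_const_def
    using f by (intro sum.cong refl arg_cong2[where f = "(*)"] linear_functional_expand[OF _ _ v])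
      (auto simp: is_product_def idx)
  finally show "f u v $ r = struct_product d (struct_const d f) u v $ r"
    using r by (simp add: struct_product_def sum_distrib_left mult.assoc)
qed

text \<open>For k \<ge> d, \<open>unit_vec d k\<close> is the zero vector, still in the carrier, so
  the symmetry of \<open>f\<close> covers every index.\<close>

lemma struct_const_commute:
  assumes "is_product d f"
  shows "struct_const d f k l r = struct_const d f l k r"
  using assms by (simp add: struct_const_def is_product_def)

text \<open>This is coordinate \<open>r\<close> of the associative law for three unit
  vectors.\<close>

lemma struct_const_assoc:
  assumes f: "is_product d f" and r: "r < d" and kmd: "k < d" "m < d"
  shows "(\<Sum>s<d. struct_const d f k l s * struct_const d f s m r)
       = (\<Sum>s<d. struct_const d f l m s * struct_const d f k s r)"
proof -
  let ?e = "unit_vec d :: nat \<Rightarrow> 'a vec"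
  have car: "f (?e i) (?e j) \<in> carrier_vec d" for i j using f by (simp add: is_product_def)
  \<comment> \<open>Collapses a sum against a Kronecker delta. Where it is used,
    \<open>index_unit_vec\<close> is switched off so that the pattern survives.\<close>
  have pick: "(\<Sum>j<d. g j * (?e i $ j) * h j) = g i * h i" if "i < d" for i and g h :: "nat \<Rightarrow> 'a"
  proof -
    have "(\<Sum>j<d. g j * (?e i $ j) * h j) = (\<Sum>j<d. if j = i then g i * h i else 0)"
      using that by (intro sum.cong) auto
    then show ?thesis using that by simp
  qed
  have "f (f (?e k) (?e l)) (?e m) $ r
      = (\<Sum>s<d. \<Sum>t<d. struct_const d f k l s * ?e m $ t * struct_const d f s t r)"
    \<comment> \<open>With \<open>car\<close> supplied, only the outer product is expanded; the
      coordinates of the inner one then are structure constants.\<close>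
    using r by (simp add: is_product_expand[OF f car] struct_product_def)
       (simp add: struct_const_def)
  also have "\<dots> = (\<Sum>s<d. struct_const d f k l s * struct_const d f s m r)"
    using kmd by (simp add: pick del: index_unit_vec)
  finally have left: "f (f (?e k) (?e l)) (?e m) $ r = \<dots>" .
  have "f (?e k) (f (?e l) (?e m)) $ r
      = (\<Sum>t<d. \<Sum>s<d. ?e k $ t * struct_const d f l m s * struct_const d f t s r)"
    using r by (simp add: is_product_expand[OF f _ car] struct_product_def)
       (simp add: struct_const_def)
  \<comment> \<open>The sum containing the delta must be innermost for \<open>pick\<close>.\<close>
  also have "\<dots> = (\<Sum>s<d. \<Sum>t<d. struct_const d f l m s * ?e k $ t * struct_const d f t s r)"
    by (subst sum.swap) (simp add: mult_ac)
  also have "\<dots> = (\<Sum>s<d. struct_const d f l m s * struct_const d f k s r)"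
    using kmd by (simp add: pick del: index_unit_vec)
  finally have "f (?e k) (f (?e l) (?e m)) $ r = \<dots>" .
  moreover have "f (f (?e k) (?e l)) (?e m) = f (?e k) (f (?e l) (?e m))"
    using f unfolding is_product_def by (metis unit_vec_carrier)
  ultimately show ?thesis using left by simp
qed

text \<open>The converse direction: the identities between constants suffice. Commutativity comes
  first, so that linearity in the second argument follows from the first. For associativity both
  sides become fourfold sums in which \<open>assoc\<close> equates the sums over
  \<open>s\<close>.\<close>

lemma is_product_struct_product:
  fixes c :: "nat \<Rightarrow> nat \<Rightarrow> nat \<Rightarrow> 'k::field"
  assumes comm: "\<And>k l r. c k l r = c l k r"
    and assoc: "\<And>k l m r. k < d \<Longrightarrow> l < d \<Longrightarrow> m < d \<Longrightarrow> r < d \<Longrightarrow>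
                  (\<Sum>s<d. c k l s * c s m r) = (\<Sum>s<d. c l m s * c k s r)"
  shows "is_product d (struct_product d c)"
proof -
  let ?f = "struct_product d c"
  have commute: "?f u v = ?f v u" for u v
    unfolding struct_product_def
    by (intro arg_cong[where f = "vec d"] ext, subst sum.swap) (simp add: mult_ac comm)
  have add: "?f (u + v) w = ?f u w + ?f v w"
    if "u \<in> carrier_vec d" "v \<in> carrier_vec d" for u v w
    using that by (intro eq_vecI) (simp_all add: struct_product_def sum.distrib distrib_right)
  have smult: "?f (a \<cdot>\<^sub>v u) v = a \<cdot>\<^sub>v ?f u v" if "u \<in> carrier_vec d" for a u v
    using that by (intro eq_vecI) (simp_all add: struct_product_def sum_distrib_left mult_ac)
  have add_right: "?f u (v + w) = ?f u v + ?f u w"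
    if "v \<in> carrier_vec d" "w \<in> carrier_vec d" for u v w
    using add[OF that, of u] by (simp add: commute[of u])
  have smult_right: "?f u (a \<cdot>\<^sub>v v) = a \<cdot>\<^sub>v ?f u v" if "v \<in> carrier_vec d" for a u v
    using smult[OF that, of a u] by (simp add: commute[of u])
  have "?f (?f u v) w = ?f u (?f v w)" for u v w
  proof (rule eq_vecI)
    fix r assume "r < dim_vec (?f u (?f v w))"
    then have r: "r < d" by (simp add: struct_product_def)
    have "?f (?f u v) w $ r
        = (\<Sum>s<d. \<Sum>m<d. \<Sum>k<d. \<Sum>l<d. u $ k * v $ l * w $ m * (c k l s * c s m r))"
      \<comment> \<open>The expansion yields the order s, m, k, l. The next swaps bring
        \<open>s\<close> innermost, where \<open>assoc\<close> applies.\<close>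
      using r by (simp add: struct_product_def sum_distrib_left sum_distrib_right mult_ac)
    also have "\<dots> = (\<Sum>m<d. \<Sum>s<d. \<Sum>k<d. \<Sum>l<d. u $ k * v $ l * w $ m * (c k l s * c s m r))"
      by (rule sum.swap)
    also have "\<dots> = (\<Sum>m<d. \<Sum>k<d. \<Sum>s<d. \<Sum>l<d. u $ k * v $ l * w $ m * (c k l s * c s m r))"
      by (intro sum.cong refl sum.swap)
    also have "\<dots> = (\<Sum>m<d. \<Sum>k<d. \<Sum>l<d. \<Sum>s<d. u $ k * v $ l * w $ m * (c k l s * c s m r))"
      by (intro sum.cong refl sum.swap)
    also have "\<dots> = (\<Sum>m<d. \<Sum>k<d. \<Sum>l<d. \<Sum>s<d. u $ k * v $ l * w $ m * (c l m s * c k s r))"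
      using r by (simp add: sum_distrib_left[symmetric] assoc)
    \<comment> \<open>From here the sums are moved to the order k, s, l, m, in which the right-hand
      product expands.\<close>
    also have "\<dots> = (\<Sum>k<d. \<Sum>m<d. \<Sum>l<d. \<Sum>s<d. u $ k * v $ l * w $ m * (c l m s * c k s r))"
      by (rule sum.swap)
    also have "\<dots> = (\<Sum>k<d. \<Sum>l<d. \<Sum>m<d. \<Sum>s<d. u $ k * v $ l * w $ m * (c l m s * c k s r))"
      by (intro sum.cong refl sum.swap)
    also have "\<dots> = (\<Sum>k<d. \<Sum>l<d. \<Sum>s<d. \<Sum>m<d. u $ k * v $ l * w $ m * (c l m s * c k s r))"
      by (intro sum.cong refl sum.swap)
    also have "\<dots> = (\<Sum>k<d. \<Sum>s<d. \<Sum>l<d. \<Sum>m<d. u $ k * v $ l * w $ m * (c l m s * c k s r))"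
      by (intro sum.cong refl sum.swap)
    also have "\<dots> = ?f u (?f v w) $ r"
      using r by (simp add: struct_product_def sum_distrib_left sum_distrib_right mult_ac)
    finally show "?f (?f u v) w $ r = ?f u (?f v w) $ r" .
  qed (simp add: struct_product_def)
  moreover have "?f u v \<in> carrier_vec d" for u v by (simp add: struct_product_def)
  ultimately show ?thesis
    unfolding is_product_def using commute add smult add_right smult_right by simp
qed

section \<open>The tensor product of two algebras and of two models\<close>

lemma tensor_vec_carrier [simp]:
  assumes "a \<in> carrier_vec m" "b \<in> carrier_vec n"
  shows "tensor_vec a b \<in> carrier_vec (m * n)"
  using assms by (simp add: tensor_vec_def)

lemma tensor_vec_index:
  assumes "a \<in> carrier_vec m" "b \<in> carrier_vec n" "k < m * n"
  shows "tensor_vec a b $ k = a $ (k div n) * b $ (k mod n)"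
  using assms by (auto simp: tensor_vec_def)

text \<open>Shows that the final vector \<alpha> \<otimes> \<beta>, read as a functional, multiplies
  the values of \<alpha> and \<beta> on pure tensors.\<close>

lemma scalar_prod_tensor_vec:
  assumes "a1 \<in> carrier_vec m" "b1 \<in> carrier_vec n" "a2 \<in> carrier_vec m" "b2 \<in> carrier_vec n"
  shows "tensor_vec a1 b1 \<bullet> tensor_vec a2 b2 = (a1 \<bullet> a2) * (b1 \<bullet> b2)"
proof -
  have "tensor_vec a1 b1 \<bullet> tensor_vec a2 b2
      = (\<Sum>k<m * n. (a1 $ (k div n) * a2 $ (k div n)) * (b1 $ (k mod n) * b2 $ (k mod n)))"
    using assms tensor_vec_carrier[OF assms(3,4)]
    by (auto simp: scalar_prod_def atLeast0LessThan tensor_vec_index mult_ac intro!: sum.cong)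
  also have "\<dots> = (\<Sum>i<m. a1 $ i * a2 $ i) * (\<Sum>j<n. b1 $ j * b2 $ j)"
    by (rule sum_mult_div_mod_prod)
  also have "\<dots> = (a1 \<bullet> a2) * (b1 \<bullet> b2)"
    using assms by (simp add: scalar_prod_def atLeast0LessThan)
  finally show ?thesis .
qed

text \<open>Pure tensors do not in general exhaust the space, so the product is first defined on all
  vectors through structure constants and only then evaluated on pure tensors.\<close>

lemma tensor_product_exists:
  fixes f g :: "'k::field vec \<Rightarrow> 'k vec \<Rightarrow> 'k vec"
  assumes f: "is_product m f" and g: "is_product n g"
  shows "\<exists>h. is_product (m * n) h \<and>
           (\<forall>a1\<in>carrier_vec m. \<forall>a2\<in>carrier_vec m. \<forall>b1\<in>carrier_vec n. \<forall>b2\<in>carrier_vec n.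
              h (tensor_vec a1 b1) (tensor_vec a2 b2) = tensor_vec (f a1 a2) (g b1 b2))"
proof -
  define cf where "cf = struct_const m f"
  define cg where "cg = struct_const n g"
  \<comment> \<open>Forced by the requirement on pure tensors, because the unit vector of index
    \<open>k\<close> is the tensor of those of indices \<open>k div n\<close> and
    \<open>k mod n\<close>.\<close>
  define c where "c k l r = cf (k div n) (l div n) (r div n) * cg (k mod n) (l mod n) (r mod n)"
    for k l r
  have bounds: "k div n < m" "k mod n < n" if "k < m * n" for k
    using that by (auto simp: less_mult_imp_div_less intro!: mod_less_divisor Nat.gr0I)
  have "is_product (m * n) (struct_product (m * n) c)"
  proof (rule is_product_struct_product)
    show "c k l r = c l k r" for k l r
      using struct_const_commute[OF f] struct_const_commute[OF g]
      unfolding c_def cf_def cg_def by metis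
    fix k l p r assume lt: "k < m * n" "l < m * n" "p < m * n" "r < m * n"
    have "(\<Sum>s<m * n. c k l s * c s p r)
        = (\<Sum>s<m * n. (cf (k div n) (l div n) (s div n) * cf (s div n) (p div n) (r div n)) *
             (cg (k mod n) (l mod n) (s mod n) * cg (s mod n) (p mod n) (r mod n)))"
      by (simp add: c_def mult_ac)
    also have "\<dots> = (\<Sum>s<m. cf (k div n) (l div n) s * cf s (p div n) (r div n)) *
        (\<Sum>s<n. cg (k mod n) (l mod n) s * cg s (p mod n) (r mod n))"
      by (rule sum_mult_div_mod_prod)
    \<comment> \<open>Once the sum has factored, associativity of \<open>f\<close> and of
      \<open>g\<close> acts on each factor separately.\<close>
    also have "\<dots> = (\<Sum>s<m. cf (l div n) (p div n) s * cf (k div n) s (r div n)) *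
        (\<Sum>s<n. cg (l mod n) (p mod n) s * cg (k mod n) s (r mod n))"
      unfolding cf_def cg_def using lt bounds
      by (simp add: struct_const_assoc[OF f] struct_const_assoc[OF g])
    also have "\<dots> = (\<Sum>s<m * n. (cf (l div n) (p div n) (s div n) * cf (k div n) (s div n) (r div n)) *
             (cg (l mod n) (p mod n) (s mod n) * cg (k mod n) (s mod n) (r mod n)))"
      by (rule sum_mult_div_mod_prod[symmetric])
    also have "\<dots> = (\<Sum>s<m * n. c l p s * c k s r)"
      by (simp add: c_def mult_ac)
    finally show "(\<Sum>s<m * n. c k l s * c s p r) = (\<Sum>s<m * n. c l p s * c k s r)" .
  qed
  moreover have "struct_product (m * n) c (tensor_vec a1 b1) (tensor_vec a2 b2)
      = tensor_vec (f a1 a2) (g b1 b2)"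
    if car: "a1 \<in> carrier_vec m" "a2 \<in> carrier_vec m" "b1 \<in> carrier_vec n" "b2 \<in> carrier_vec n"
    for a1 a2 b1 b2
  proof (rule eq_vecI)
    have fg: "f a1 a2 \<in> carrier_vec m" "g b1 b2 \<in> carrier_vec n"
      using f g car by (simp_all add: is_product_def)
    then have carr: "tensor_vec (f a1 a2) (g b1 b2) \<in> carrier_vec (m * n)" by simp
    then show "dim_vec (struct_product (m * n) c (tensor_vec a1 b1) (tensor_vec a2 b2))
        = dim_vec (tensor_vec (f a1 a2) (g b1 b2))"
      by (simp add: struct_product_def)
    fix r assume "r < dim_vec (tensor_vec (f a1 a2) (g b1 b2))"
    then have r: "r < m * n" using carr by simp
    let ?F = "\<lambda>i k. a1 $ i * a2 $ k * cf i k (r div n)"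
    let ?G = "\<lambda>j l. b1 $ j * b2 $ l * cg j l (r mod n)"
    have "struct_product (m * n) c (tensor_vec a1 b1) (tensor_vec a2 b2) $ r
        = (\<Sum>k<m * n. \<Sum>l<m * n. ?F (k div n) (l div n) * ?G (k mod n) (l mod n))"
      using r car by (simp add: struct_product_def tensor_vec_index c_def mult_ac)
    \<comment> \<open>Factoring the inner sum leaves a summand that again separates into a quotient
      part and a remainder part, so the outer sum factors too.\<close>
    also have "\<dots> = (\<Sum>k<m * n. (\<Sum>l<m. ?F (k div n) l) * (\<Sum>l<n. ?G (k mod n) l))"
      by (intro sum.cong refl sum_mult_div_mod_prod)
    also have "\<dots> = (\<Sum>k<m. \<Sum>l<m. ?F k l) * (\<Sum>k<n. \<Sum>l<n. ?G k l)"
      by (rule sum_mult_div_mod_prod)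
    also have "\<dots> = f a1 a2 $ (r div n) * g b1 b2 $ (r mod n)"
      using bounds[OF r] car
      by (simp add: is_product_expand[OF f] is_product_expand[OF g] struct_product_def cf_def cg_def)
    also have "\<dots> = tensor_vec (f a1 a2) (g b1 b2) $ r"
      using fg r by (simp add: tensor_vec_index)
    finally show "struct_product (m * n) c (tensor_vec a1 b1) (tensor_vec a2 b2) $ r
        = tensor_vec (f a1 a2) (g b1 b2) $ r" .
  qed
  ultimately show ?thesis by blast
qed

lemma tensor_hwm_exists:
  assumes A: "is_hwm A" and B: "is_hwm B"
  shows "\<exists>D. is_tensor_hwm \<Sigma> ar A B D"
proof -
  let ?m = "hwm_rank A" and ?n = "hwm_rank B"
  obtain h where h: "is_product (?m * ?n) h"
    "\<And>a1 a2 b1 b2. a1 \<in> carrier_vec ?m \<Longrightarrow> a2 \<in> carrier_vec ?m \<Longrightarrow>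
       b1 \<in> carrier_vec ?n \<Longrightarrow> b2 \<in> carrier_vec ?n \<Longrightarrow>
       h (tensor_vec a1 b1) (tensor_vec a2 b2)
         = tensor_vec (hwm_product A a1 a2) (hwm_product B b1 b2)"
    using tensor_product_exists[of ?m "hwm_product A" ?n "hwm_product B"] A B
    unfolding is_hwm_def by blast
  define D where "D = \<lparr>hwm_rank = ?m * ?n,
     hwm_tensor = (\<lambda>x ks. hwm_tensor A x (map (\<lambda>k. k div ?n) ks) * hwm_tensor B x (map (\<lambda>k. k mod ?n) ks)),
     hwm_product = h, hwm_final = tensor_vec (hwm_final A) (hwm_final B)\<rparr>"
  have split: "map (\<lambda>k. k div ?n) (map2 (\<lambda>i j. ?n * i + j) is js) = is \<and>
      map (\<lambda>k. k mod ?n) (map2 (\<lambda>i j. ?n * i + j) is js) = js"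
    if "length is = length js" "set js \<subseteq> {0..<?n}" for "is" js
    using that by (induction "is" js rule: list_induct2) auto
  have "is_hwm D"
    using A B h(1) by (auto simp: is_hwm_def D_def Suc_le_eq)
  then have "is_tensor_hwm \<Sigma> ar A B D"
    \<comment> \<open>Fusing the nested maps would destroy the left-hand sides of
      \<open>split\<close>.\<close>
    unfolding is_tensor_hwm_def using h(2) by (auto simp: D_def split simp del: map_map)
  then show ?thesis by blast
qed

section \<open>Iterated products of pure tensors\<close>

text \<open>\<open>big_product_insert\<close> gives membership only in the presence of a point
  outside \<open>h\<close>; induction over non-empty finite sets removes that condition.\<close>

lemma big_product_carrier:
  assumes f: "is_product d f" and h: "finite h" "h \<noteq> {}"
    and g: "\<And>p. p \<in> h \<Longrightarrow> g p \<in> carrier_vec d"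
  shows "big_product f g h \<in> carrier_vec d"
  using h g
proof (induction h rule: finite_ne_induct)
  case (singleton p)
  then show ?case by (simp add: big_product_singleton)
next
  case (insert p h)
  then have "big_product f g (insert p h) = f (g p) (big_product f g h)"
    by (intro big_product_insert[OF f]) auto
  then show ?case using insert f by (simp add: is_product_def)
qed

text \<open>Multiplying pure tensors gives a pure tensor, so at each insertion the rule for
  \<open>F\<close> on pure tensors applies again.\<close>

lemma big_product_tensor:
  assumes prods: "is_product m f" "is_product n f'" "is_product (m * n) F"
    and F: "\<And>a1 a2 b1 b2. a1 \<in> carrier_vec m \<Longrightarrow> a2 \<in> carrier_vec m \<Longrightarrow>
       b1 \<in> carrier_vec n \<Longrightarrow> b2 \<in> carrier_vec n \<Longrightarrow>
       F (tensor_vec a1 b1) (tensor_vec a2 b2) = tensor_vec (f a1 a2) (f' b1 b2)"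
    and h: "finite h" "h \<noteq> {}"
    and g: "\<And>p. p \<in> h \<Longrightarrow> g p \<in> carrier_vec m" "\<And>p. p \<in> h \<Longrightarrow> g' p \<in> carrier_vec n"
      "\<And>p. p \<in> h \<Longrightarrow> G p = tensor_vec (g p) (g' p)"
  shows "big_product F G h = tensor_vec (big_product f g h) (big_product f' g' h)"
  using h g
proof (induction h rule: finite_ne_induct)
  case (singleton p)
  then show ?case by (simp add: big_product_singleton)
next
  case (insert p h)
  have "big_product F G (insert p h) = F (G p) (big_product F G h)"
    using insert by (intro big_product_insert[OF prods(3)]) auto
  also have "\<dots> = F (tensor_vec (g p) (g' p)) (tensor_vec (big_product f g h) (big_product f' g' h))"
    using insert by simp
  also have "\<dots> = tensor_vec (f (g p) (big_product f g h)) (f' (g' p) (big_product f' g' h))"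
    using insert by (intro F big_product_carrier[OF prods(1)] big_product_carrier[OF prods(2)]) auto
  also have "f (g p) (big_product f g h) = big_product f g (insert p h)"
    using insert by (intro big_product_insert(1)[OF prods(1), symmetric]) auto
  also have "f' (g' p) (big_product f' g' h) = big_product f' g' (insert p h)"
    using insert by (intro big_product_insert(1)[OF prods(2), symmetric]) auto
  finally show ?case .
qed

section \<open>Factoring the series\<close>

text \<open>The quotient-remainder bijection is applied at each point of \<open>P\<close>. The
  restrictions to \<open>P\<close> keep all maps extensional, so that the two directions are
  mutually inverse.\<close>

lemma sum_PiE_mult:
  fixes f :: "('p \<Rightarrow> nat) \<Rightarrow> 'a::comm_monoid_add"
  shows "(\<Sum>\<gamma>\<in>P \<rightarrow>\<^sub>E {0..<m * n}. f \<gamma>)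
       = (\<Sum>(\<gamma>1, \<gamma>2)\<in>(P \<rightarrow>\<^sub>E {0..<m}) \<times> (P \<rightarrow>\<^sub>E {0..<n}). f (\<lambda>p\<in>P. n * \<gamma>1 p + \<gamma>2 p))"
proof (rule sum.reindex_bij_witness[symmetric,
    where i = "\<lambda>\<gamma>. (\<lambda>p\<in>P. \<gamma> p div n, \<lambda>p\<in>P. \<gamma> p mod n)"
      and j = "\<lambda>(\<gamma>1, \<gamma>2). \<lambda>p\<in>P. n * \<gamma>1 p + \<gamma>2 p"])
  fix \<gamma> assume \<gamma>: "\<gamma> \<in> P \<rightarrow>\<^sub>E {0..<m * n}"
  have "\<gamma> p div n < m" "\<gamma> p mod n < n" if "p \<in> P" for p
    using PiE_mem[OF \<gamma> that]
    by (auto simp: less_mult_imp_div_less intro!: mod_less_divisor Nat.gr0I)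
  then show "(\<lambda>p\<in>P. \<gamma> p div n, \<lambda>p\<in>P. \<gamma> p mod n) \<in> (P \<rightarrow>\<^sub>E {0..<m}) \<times> (P \<rightarrow>\<^sub>E {0..<n})"
    by auto
  show "(case (\<lambda>p\<in>P. \<gamma> p div n, \<lambda>p\<in>P. \<gamma> p mod n) of
      (\<gamma>1, \<gamma>2) \<Rightarrow> \<lambda>p\<in>P. n * \<gamma>1 p + \<gamma>2 p) = \<gamma>"
    \<comment> \<open>Outside \<open>P\<close> both sides are \<open>undefined\<close>.\<close>
    using PiE_arb[OF \<gamma>] by (auto simp: fun_eq_iff)
next
  fix q assume "q \<in> (P \<rightarrow>\<^sub>E {0..<m}) \<times> (P \<rightarrow>\<^sub>E {0..<n})"
  then obtain \<gamma>1 \<gamma>2 where q: "q = (\<gamma>1, \<gamma>2)" "\<gamma>1 \<in> P \<rightarrow>\<^sub>E {0..<m}" "\<gamma>2 \<in> P \<rightarrow>\<^sub>E {0..<n}" by auto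
  have lt: "\<gamma>1 p < m" "\<gamma>2 p < n" if "p \<in> P" for p using q that by auto
  have dm: "(n * \<gamma>1 p + \<gamma>2 p) div n = \<gamma>1 p" "(n * \<gamma>1 p + \<gamma>2 p) mod n = \<gamma>2 p" if "p \<in> P" for p
    using lt(2)[OF that] by simp_all
  have "n * \<gamma>1 p + \<gamma>2 p < m * n" if "p \<in> P" for p
  proof -
    have "n * \<gamma>1 p + \<gamma>2 p < n * Suc (\<gamma>1 p)" using lt[OF that] by simp
    also have "\<dots> \<le> n * m" using lt[OF that] by (intro mult_le_mono2) simp
    finally show ?thesis by (simp add: mult.commute)
  qed
  then show "(case q of (\<gamma>1, \<gamma>2) \<Rightarrow> \<lambda>p\<in>P. n * \<gamma>1 p + \<gamma>2 p) \<in> P \<rightarrow>\<^sub>E {0..<m * n}"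
    using q by auto
  show "(\<lambda>p\<in>P. (case q of (\<gamma>1, \<gamma>2) \<Rightarrow> \<lambda>p\<in>P. n * \<gamma>1 p + \<gamma>2 p) p div n,
      \<lambda>p\<in>P. (case q of (\<gamma>1, \<gamma>2) \<Rightarrow> \<lambda>p\<in>P. n * \<gamma>1 p + \<gamma>2 p) p mod n) = q"
    using dm PiE_arb[OF q(2)] PiE_arb[OF q(3)] by (auto simp: fun_eq_iff q(1))
qed auto

text \<open>Makes every hyperedge finite, as induction along a hyperedge requires.\<close>

lemma finite_ports:
  assumes "finite (verts G)"
  shows "finite (ports ar G)"
proof -
  have "ports ar G = (SIGMA v:verts G. {1..ar (lab G v)})" by (auto simp: ports_def)
  then show ?thesis using assms by simp
qed

text \<open>The specification of \<open>D\<close> fixes all that the series reads: tensor entries at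
  indices in range, iterated products of unit vectors, which are pure tensors, and the final
  vector.\<close>

lemma hwm_series_tensor:
  assumes A: "is_hwm A" and B: "is_hwm B" and D: "is_tensor_hwm \<Sigma> ar A B D"
    and G: "is_hypergraph \<Sigma> ar G"
  shows "hwm_series ar D G = hwm_series ar A G * hwm_series ar B G"
proof -
  let ?m = "hwm_rank A" and ?n = "hwm_rank B" and ?P = "ports ar G"
  let ?ix = "\<lambda>\<gamma> v. map (\<lambda>j. \<gamma> (v, j)) [1..<Suc (ar (lab G v))]"
  let ?T = "\<lambda>M \<gamma>. \<Prod>v\<in>verts G. hwm_tensor M (lab G v) (?ix \<gamma> v)"
  let ?b = "\<lambda>M \<gamma>. big_product (hwm_product M) (\<lambda>p. unit_vec (hwm_rank M) (\<gamma> p))"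
  let ?H = "\<lambda>M \<gamma>. \<Prod>h\<in>hyperedges G. hwm_final M \<bullet> ?b M \<gamma> h"
  have rank: "hwm_rank D = ?m * ?n" and final: "hwm_final D = tensor_vec (hwm_final A) (hwm_final B)"
    using D by (simp_all add: is_tensor_hwm_def)
  have *: "?T D \<gamma> * ?H D \<gamma> = (?T A \<gamma>1 * ?H A \<gamma>1) * (?T B \<gamma>2 * ?H B \<gamma>2)"
    if \<gamma>1: "\<gamma>1 \<in> ?P \<rightarrow>\<^sub>E {0..<?m}" and \<gamma>2: "\<gamma>2 \<in> ?P \<rightarrow>\<^sub>E {0..<?n}"
      and \<gamma>: "\<gamma> = (\<lambda>p\<in>?P. ?n * \<gamma>1 p + \<gamma>2 p)" for \<gamma> \<gamma>1 \<gamma>2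
  proof -
    have lt: "\<gamma>1 p < ?m" "\<gamma>2 p < ?n" if "p \<in> ?P" for p using \<gamma>1 \<gamma>2 that by auto
    have "hwm_tensor D (lab G v) (?ix \<gamma> v)
        = hwm_tensor A (lab G v) (?ix \<gamma>1 v) * hwm_tensor B (lab G v) (?ix \<gamma>2 v)"
      if v: "v \<in> verts G" for v
    proof -
      have port: "(v, j) \<in> ?P" if "j \<in> set [1..<Suc (ar (lab G v))]" for j
        using v that by (auto simp: ports_def)
      \<comment> \<open>Ports are counted from 1 to the arity, so each \<open>(v, j)\<close> lies in
        \<open>?P\<close>, where the restricted map \<gamma> has its encoded value.\<close>
      have "?ix \<gamma> v = map2 (\<lambda>i j. ?n * i + j) (?ix \<gamma>1 v) (?ix \<gamma>2 v)"
        unfolding zip_map_map zip_same_conv_map map_map using port by (intro map_cong refl) (auto simp: \<gamma>)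
      moreover have "set (?ix \<gamma>1 v) \<subseteq> {0..<?m}" "set (?ix \<gamma>2 v) \<subseteq> {0..<?n}"
        using port lt by fastforce+
      moreover have "lab G v \<in> \<Sigma>" using G v by (simp add: is_hypergraph_def)
      moreover have "length (?ix \<gamma>1 v) = ar (lab G v)" "length (?ix \<gamma>2 v) = ar (lab G v)" by simp_all
      ultimately show ?thesis using D unfolding is_tensor_hwm_def by metis
    qed
    then have T: "?T D \<gamma> = ?T A \<gamma>1 * ?T B \<gamma>2" by (simp add: prod.distrib)
    have "hwm_final D \<bullet> ?b D \<gamma> h = (hwm_final A \<bullet> ?b A \<gamma>1 h) * (hwm_final B \<bullet> ?b B \<gamma>2 h)"
      if h: "h \<in> hyperedges G" for h
    proof -
      have "partition_on ?P (hyperedges G)" using G by (simp add: is_hypergraph_def)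
      then have hP: "h \<subseteq> ?P" and ne: "h \<noteq> {}" using h by (auto simp: partition_on_def)
      have fin: "finite h"
        using finite_subset[OF hP finite_ports] G by (simp add: is_hypergraph_def)
      have prods: "is_product ?m (hwm_product A)" "is_product ?n (hwm_product B)"
        "is_product (?m * ?n) (hwm_product D)"
        using A B D rank by (auto simp: is_hwm_def is_tensor_hwm_def)
      \<comment> \<open>Each port contributes a unit vector whose index encodes a pair, hence a pure
        tensor.\<close>
      have "?b D \<gamma> h = tensor_vec (?b A \<gamma>1 h) (?b B \<gamma>2 h)"
      proof (rule big_product_tensor[OF prods _ fin ne])
        fix p assume "p \<in> h"
        then have "p \<in> ?P" using hP by auto
        then show "unit_vec (hwm_rank D) (\<gamma> p) = tensor_vec (unit_vec ?m (\<gamma>1 p)) (unit_vec ?n (\<gamma>2 p))"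
          using lt[of p] by (simp add: \<gamma> rank tensor_vec_unit_vec)
      qed (use D in \<open>auto simp: is_tensor_hwm_def\<close>)
      moreover have "?b A \<gamma>1 h \<in> carrier_vec ?m" "?b B \<gamma>2 h \<in> carrier_vec ?n"
        using prods fin ne by (auto intro: big_product_carrier)
      ultimately show ?thesis
        using A B scalar_prod_tensor_vec[of "hwm_final A" ?m "hwm_final B" ?n]
        by (simp add: final is_hwm_def)
    qed
    then have "?H D \<gamma> = ?H A \<gamma>1 * ?H B \<gamma>2" by (simp add: prod.distrib)
    with T show ?thesis by (simp add: mult_ac)
  qed
  have "hwm_series ar D G = (\<Sum>(\<gamma>1, \<gamma>2)\<in>(?P \<rightarrow>\<^sub>E {0..<?m}) \<times> (?P \<rightarrow>\<^sub>E {0..<?n}).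
      (?T A \<gamma>1 * ?H A \<gamma>1) * (?T B \<gamma>2 * ?H B \<gamma>2))"
    unfolding hwm_series_def rank sum_PiE_mult
    using * by (intro sum.cong refl) (auto simp: rank)
  also have "\<dots> = hwm_series ar A G * hwm_series ar B G"
    unfolding hwm_series_def by (simp only: sum_product sum.cartesian_product)
  finally show ?thesis .
qed

text \<open>Existence of \<open>D\<close> keeps the identity from being vacuous, since its
  specification prescribes products on pure tensors only. Both scalar fields are instances of
  results over an arbitrary field.\<close>

theorem proposition5:
  fixes \<Sigma> :: "'x set" and ar :: "'x \<Rightarrow> nat"
  assumes "positive_ranked_alphabet \<Sigma> ar"
  shows "(\<forall>A B :: ('x, real) hwm. is_hwm A \<and> is_hwm B \<longrightarrow>
            (\<exists>D. is_tensor_hwm \<Sigma> ar A B D) \<and>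
            (\<forall>D. is_tensor_hwm \<Sigma> ar A B D \<longrightarrow>
               (\<forall>G :: ('v, 'x) hypergraph. is_hypergraph \<Sigma> ar G \<longrightarrow>
                  hwm_series ar D G = hwm_series ar A G * hwm_series ar B G)))
       \<and> (\<forall>A B :: ('x, complex) hwm. is_hwm A \<and> is_hwm B \<longrightarrow>
            (\<exists>D. is_tensor_hwm \<Sigma> ar A B D) \<and>
            (\<forall>D. is_tensor_hwm \<Sigma> ar A B D \<longrightarrow>
               (\<forall>G :: ('v, 'x) hypergraph. is_hypergraph \<Sigma> ar G \<longrightarrow>
                  hwm_series ar D G = hwm_series ar A G * hwm_series ar B G)))"
  by (blast intro: tensor_hwm_exists hwm_series_tensor)

end
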